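(* Assume that the initial states $\{s_1^k\}_{k=1}^K$ are such that $\Delta_0(K)$ is not empty, i.e. there is a Markovian policy $\pi\in\Delta$ with $V^\pi_{c,1}(s_1^k)=0$ for every $k=1,\dots,K$. Let $(\pi^*,\lambda^* )$ be the shared saddle-point with $\lambda^*=\hat\lambda+1$ described in the context. Then for any sequences $\{\pi^k\}_{k=1}^K$ of policies in $\Delta$ and $\{\lambda^k\}_{k=1}^K$ of functions $\mathcal{S}\to\mathbb{R}$, $$\mathrm{Regret}(K)\le R_p(\{\pi^k\}_{k=1}^K,\pi^* )+R_d(\{\lambda^k\}_{k=1}^K,0),$$ $$\mathrm{Resets}(K)\le R_p(\{\pi^k\}_{k=1}^K,\pi^* )+R_d(\{\lambda^k\}_{k=1}^K,\lambda^* ).$$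
   Context: Setting. $(\mathcal{S},\mathcal{A},P,r,H)$ is a finite-horizon MDP with state space $\mathcal{S}$ (possibly large or continuous), action space $\mathcal{A}$ (relatively small, so that maxima over $a\in\mathcal{A}$ can be performed), transition dynamics $P=\{P_h\}_{h=1}^H$, deterministic rewards $r=\{r_h\}_{h=1}^H$ with $r_h:\mathcal{S}\times\mathcal{A}\to[0,1]$, and horizon $H$. The state space is layered: a state at time $h$ has the form $(\bar s,h)$. $\mathcal{S}_{reset}\subseteq\mathcal{S}$ is the set of reset states (membership depends only on the time-invariant part $\bar s$). The cost is $c_h(s,a)=\mathds{1}[s\in\mathcal{S}_{reset}]$. $\mathcal{S}$ contains a fictitious absorbing state $s^\dagger$ with $r_h(s^\dagger,a)=c_h(s^\dagger,a)=0$; from $s^\dagger$ the agent stays at $s^\dagger$ until the end of the episode, and from any $s\in\mathcal{S}_{reset}$ every action leads to $s^\dagger$ in the next step. $\Delta$ is the set of Markovian policies $\pi=\{\pi_h(a_h|s_h)\}_{h=1}^H$. For $g\in\{r,c\}$, $V^\pi_{g,h}(s)=\mathbb{E}_\pi[\sum_{t=h}^H g_t(s_t,a_t)\mid s_h=s]$. A state $s_1$ is feasible if some $\pi\in\Delta$ has $V^\pi_{c,1}(s_1)\le0$. There are $K$ episodes; $s_1^k$ is the initial state of episode $k$ (it may depend on past behavior) and $\pi^k$ the policy used in episode $k$. $\Delta_0(K)=\{\pi\in\Delta: V^\pi_{c,1}(s_1^k)=0,\ k=1,\dots,K\}$ is the set of Markovian policies avoiding resets in all episodes. Performance measures: $$\mathrm{Regret}(K)=\max_{\pi\in\Delta_0(K)}\sum_{k=1}^K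 V^\pi_{r,1}(s_1^k)-V^{\pi^k}_{r,1}(s_1^k),\qquad \mathrm{Resets}(K)=\sum_{k=1}^K V^{\pi^k}_{c,1}(s_1^k).$$ Two-player game: $\mathcal{L}^k(\pi,\lambda)=V^\pi_{r,1}(s_1^k)-\lambda(s_1^k)V^\pi_{c,1}(s_1^k)$. For comparators $\pi_c\in\Delta$ and $\lambda_c:\mathcal{S}\to\mathbb{R}$, $$R_p(\{\pi^k\}_{k=1}^K,\pi_c)=\sum_{k=1}^K\mathcal{L}^k(\pi_c,\lambda^k)-\mathcal{L}^k(\pi^k,\lambda^k),\quad R_d(\{\lambda^k\}_{k=1}^K,\lambda_c)=\sum_{k=1}^K\mathcal{L}^k(\pi^k,\lambda^k)-\mathcal{L}^k(\pi^k,\lambda_c).$$ The comparator $0$ is the zero function. Shared saddle-point: $\hat\lambda$ is a function with $\hat\lambda(s)\in\arg\min_{y\ge0}(\max_{\pi\in\Delta}V^\pi_{r,1}(s)-yV^\pi_{c,1}(s))$ for each feasible $s$, and $\pi^*\in\Delta$ is a Markovian policy such that for all $\pi\in\Delta$, $\lambda:\mathcal{S}\to\mathbb{R}$ and feasible $s_1$: $V^{\pi^*}_{r,1}(s_1)-\lambda(s_1)V^{\pi^*}_{c,1}(s_1)\ge V^{\pi^*}_{r,1}(s_1)-\hat\lambda(s_1)V^{\pi^*}_{c,1}(s_1)\ge V^{\pi}_{r,1}(s_1)-\hat\lambda(s_1)V^{\pi}_{c,1}(s_1)$. Set $\lambda^*=\hat\lambda+1$; $(\pi^*,\lambda^* )$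 satisfies the same saddle-point inequalities with $\lambda^*$ in place of $\hat\lambda$. *)

theory Defs
  imports "HOL-Probability.Probability"
begin

text \<open>
  The state space is layered: a state is a pair consisting of its time-invariant part and its
  time.  The time-invariant parts form an arbitrary measurable space, the action set is finite.
  Layer \<open>horizon + 1\<close> only serves as the target of the last kernel, no reward or cost is
  collected there.
\<close>

type_synonym 's state = "'s \<times> nat"
type_synonym ('s, 'a) policy = "nat \<Rightarrow> 's state \<Rightarrow> 'a measure"

record ('s, 'a) mdp =
  base_space :: "'s measure"
  actions :: "'a set"
  kernel :: "nat \<Rightarrow> 's state \<Rightarrow> 'a \<Rightarrow> 's state measure"
  reward :: "nat \<Rightarrow> 's state \<Rightarrow> 'a \<Rightarrow> real"
  horizon :: nat
  reset_parts :: "'s set"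
  sink_part :: 's

definition layer :: "('s, 'a) mdp \<Rightarrow> nat \<Rightarrow> 's state measure" where
  "layer M h = base_space M \<Otimes>\<^sub>M count_space {h}"

definition step_space :: "('s, 'a) mdp \<Rightarrow> nat \<Rightarrow> ('s state \<times> 'a) measure" where
  "step_space M h = layer M h \<Otimes>\<^sub>M count_space (actions M)"

definition reset_states :: "('s, 'a) mdp \<Rightarrow> 's state set" where
  "reset_states M = {s. fst s \<in> reset_parts M}"

definition cost :: "('s, 'a) mdp \<Rightarrow> nat \<Rightarrow> 's state \<Rightarrow> 'a \<Rightarrow> real" where
  "cost M h s a = indicator (reset_states M) s"

text \<open>The sink has cost zero precisely because its time-invariant part is not a reset part.\<close>

definition reset_mdp :: "('s, 'a) mdp \<Rightarrow> bool" where
  "reset_mdp M \<longleftrightarrow>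
     1 \<le> horizon M \<and>
     finite (actions M) \<and> actions M \<noteq> {} \<and>
     reset_parts M \<in> sets (base_space M) \<and>
     sink_part M \<in> space (base_space M) \<and> sink_part M \<notin> reset_parts M \<and>
     (\<forall>h\<in>{1..horizon M}.
        (\<lambda>(s, a). kernel M h s a) \<in> step_space M h \<rightarrow>\<^sub>M prob_algebra (layer M (Suc h)) \<and>
        (\<lambda>(s, a). reward M h s a) \<in> borel_measurable (step_space M h) \<and>
        (\<forall>s\<in>space (layer M h). \<forall>a\<in>actions M. reward M h s a \<in> {0..1}) \<and>
        (\<forall>a\<in>actions M. reward M h (sink_part M, h) a = 0) \<and>
        (\<forall>a\<in>actions M.
           kernel M h (sink_part M, h) a = return (layer M (Suc h)) (sink_part M, Suc h)) \<and>
        (\<forall>s\<in>space (layer M h) \<inter> reset_states M. \<forall>a\<in>actions M.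
           kernel M h s a = return (layer M (Suc h)) (sink_part M, Suc h)))"

definition policies :: "('s, 'a) mdp \<Rightarrow> ('s, 'a) policy set" where
  "policies M = {\<pi>. \<forall>h\<in>{1..horizon M}.
     \<pi> h \<in> layer M h \<rightarrow>\<^sub>M prob_algebra (count_space (actions M))}"

text \<open>
  \<open>trajectory M \<pi> n h s\<close> is the law of the state-action pairs at the times
  \<open>h, \<dots>, h + n - 1\<close> when \<open>\<pi>\<close> is run from the state \<open>s\<close> at time \<open>h\<close>.
\<close>

primrec trajectory ::
  "('s, 'a) mdp \<Rightarrow> ('s, 'a) policy \<Rightarrow> nat \<Rightarrow> nat \<Rightarrow> 's state \<Rightarrow> (nat \<Rightarrow> 's state \<times> 'a) measure" where
  "trajectory M \<pi> 0 = (\<lambda>h s. return (PiM {} (step_space M)) (\<lambda>_. undefined))"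
| "trajectory M \<pi> (Suc n) = (\<lambda>h s.
     bind (\<pi> h s) (\<lambda>a.
     bind (kernel M h s a) (\<lambda>s'.
     bind (trajectory M \<pi> n (Suc h) s') (\<lambda>\<tau>.
     return (PiM {h..<h + Suc n} (step_space M)) (\<tau>(h := (s, a)))))))"

lemma trajectory_measurable:
  assumes M: "reset_mdp M" and \<pi>: "\<pi> \<in> policies M" and "1 \<le> h" "h + n \<le> Suc (horizon M)"
  shows "trajectory M \<pi> n h \<in> layer M h \<rightarrow>\<^sub>M prob_algebra (PiM {h..<h + n} (step_space M))"
  using assms(3,4)
proof (induction n arbitrary: h)
  case 0
  have "(\<lambda>_. undefined) \<in> space (PiM {} (step_space M))"
    by (simp add: space_PiM)
  then show ?case
    by (simp add: measurable_const space_prob_algebra prob_space_return)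
next
  case (Suc n)
  from Suc.prems have h: "h \<in> {1..horizon M}" by simp
  let ?A = "count_space (actions M)"
  have K: "(\<lambda>(s, a). kernel M h s a) \<in> layer M h \<Otimes>\<^sub>M ?A \<rightarrow>\<^sub>M prob_algebra (layer M (Suc h))"
    using M h by (auto simp: reset_mdp_def step_space_def)
  have P: "\<pi> h \<in> layer M h \<rightarrow>\<^sub>M prob_algebra ?A"
    using \<pi> h by (auto simp: policies_def)
  have T: "trajectory M \<pi> n (Suc h)
      \<in> layer M (Suc h) \<rightarrow>\<^sub>M prob_algebra (PiM {Suc h..<Suc h + n} (step_space M))"
    using Suc.IH[of "Suc h"] Suc.prems by simp
  have I: "{h..<h + Suc n} = insert h {Suc h..<Suc h + n}" by auto
  have U: "(\<lambda>(x, \<tau>). \<tau>(h := fst x))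
      \<in> ((layer M h \<Otimes>\<^sub>M ?A) \<Otimes>\<^sub>M layer M (Suc h)) \<Otimes>\<^sub>M PiM {Suc h..<Suc h + n} (step_space M)
         \<rightarrow>\<^sub>M PiM {h..<h + Suc n} (step_space M)"
    unfolding I split_beta'
    by (rule measurable_fun_upd[where J="{Suc h..<Suc h + n}"]) (auto simp: step_space_def)
  have R: "(\<lambda>(x, \<tau>). return (PiM {h..<h + Suc n} (step_space M)) (\<tau>(h := fst x)))
      \<in> ((layer M h \<Otimes>\<^sub>M ?A) \<Otimes>\<^sub>M layer M (Suc h)) \<Otimes>\<^sub>M PiM {Suc h..<Suc h + n} (step_space M)
         \<rightarrow>\<^sub>M prob_algebra (PiM {h..<h + Suc n} (step_space M))"
    using measurable_compose[OF U measurable_return_prob_space] by (simp add: split_beta')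
  have B1: "(\<lambda>x. bind (trajectory M \<pi> n (Suc h) (snd x))
        (\<lambda>\<tau>. return (PiM {h..<h + Suc n} (step_space M)) (\<tau>(h := fst x))))
      \<in> (layer M h \<Otimes>\<^sub>M ?A) \<Otimes>\<^sub>M layer M (Suc h)
         \<rightarrow>\<^sub>M prob_algebra (PiM {h..<h + Suc n} (step_space M))"
    using R measurable_compose[OF measurable_snd T]
    by (intro measurable_bind_prob_space2[where N="PiM {Suc h..<Suc h + n} (step_space M)"]) auto
  have B2: "(\<lambda>y. bind (case y of (s, a) \<Rightarrow> kernel M h s a)
        (\<lambda>s'. bind (trajectory M \<pi> n (Suc h) s')
        (\<lambda>\<tau>. return (PiM {h..<h + Suc n} (step_space M)) (\<tau>(h := y)))))
      \<in> layer M h \<Otimes>\<^sub>M ?A \<rightarrow>\<^sub>M prob_algebra (PiM {h..<h + Suc n} (step_space M))"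
    using B1 K
    by (intro measurable_bind_prob_space2[where N="layer M (Suc h)"]) (auto simp: split_beta')
  show ?case
    using B2 P unfolding trajectory.simps
    by (intro measurable_bind_prob_space2[where N="?A"]) (auto simp: split_beta')
qed

text \<open>
  \<open>V M \<pi> g h s\<close> is the value \<open>V\<^sup>\<pi>\<^bsub>g,h\<^esub>(s)\<close>; it is used with \<open>g\<close> being
  \<open>reward M\<close> or \<open>cost M\<close>.
\<close>

definition V :: "('s, 'a) mdp \<Rightarrow> ('s, 'a) policy \<Rightarrow> (nat \<Rightarrow> 's state \<Rightarrow> 'a \<Rightarrow> real) \<Rightarrow>
    nat \<Rightarrow> 's state \<Rightarrow> real" where
  "V M \<pi> g h s = (\<integral>\<tau>. (\<Sum>t=h..horizon M. g t (fst (\<tau> t)) (snd (\<tau> t)))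
     \<partial>trajectory M \<pi> (Suc (horizon M) - h) h s)"

definition feasible :: "('s, 'a) mdp \<Rightarrow> 's state set" where
  "feasible M = {s \<in> space (layer M 1). \<exists>\<pi>\<in>policies M. V M \<pi> (cost M) 1 s \<le> 0}"

definition avoiding_policies ::
  "('s, 'a) mdp \<Rightarrow> nat \<Rightarrow> (nat \<Rightarrow> 's state) \<Rightarrow> ('s, 'a) policy set" where
  "avoiding_policies M K s1 = {\<pi> \<in> policies M. \<forall>k\<in>{1..K}. V M \<pi> (cost M) 1 (s1 k) = 0}"

text \<open>A genuine maximum: the value is unspecified if the supremum is not attained.\<close>

definition maximum_over :: "'b set \<Rightarrow> ('b \<Rightarrow> real) \<Rightarrow> real" where
  "maximum_over X f = (GREATEST v. v \<in> f ` X)"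

definition regret ::
  "('s, 'a) mdp \<Rightarrow> nat \<Rightarrow> (nat \<Rightarrow> 's state) \<Rightarrow> (nat \<Rightarrow> ('s, 'a) policy) \<Rightarrow> real" where
  "regret M K s1 \<pi>s = maximum_over (avoiding_policies M K s1)
     (\<lambda>\<pi>. \<Sum>k=1..K. (V M \<pi> (reward M) 1 (s1 k) - V M (\<pi>s k) (reward M) 1 (s1 k)))"

definition resets ::
  "('s, 'a) mdp \<Rightarrow> nat \<Rightarrow> (nat \<Rightarrow> 's state) \<Rightarrow> (nat \<Rightarrow> ('s, 'a) policy) \<Rightarrow> real" where
  "resets M K s1 \<pi>s = (\<Sum>k=1..K. V M (\<pi>s k) (cost M) 1 (s1 k))"

text \<open>The payoff \<open>\<L>\<^sup>k\<close> of episode \<open>k\<close> is \<open>lagrangian M (s1 k)\<close>.\<close>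

definition lagrangian ::
  "('s, 'a) mdp \<Rightarrow> 's state \<Rightarrow> ('s, 'a) policy \<Rightarrow> ('s state \<Rightarrow> real) \<Rightarrow> real" where
  "lagrangian M s \<pi> lam = V M \<pi> (reward M) 1 s - lam s * V M \<pi> (cost M) 1 s"

definition primal_regret ::
  "('s, 'a) mdp \<Rightarrow> nat \<Rightarrow> (nat \<Rightarrow> 's state) \<Rightarrow> (nat \<Rightarrow> ('s, 'a) policy) \<Rightarrow>
    (nat \<Rightarrow> 's state \<Rightarrow> real) \<Rightarrow> ('s, 'a) policy \<Rightarrow> real" where
  "primal_regret M K s1 \<pi>s lams \<pi>c =
     (\<Sum>k=1..K. lagrangian M (s1 k) \<pi>c (lams k) - lagrangian M (s1 k) (\<pi>s k) (lams k))"

definition dual_regret ::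
  "('s, 'a) mdp \<Rightarrow> nat \<Rightarrow> (nat \<Rightarrow> 's state) \<Rightarrow> (nat \<Rightarrow> ('s, 'a) policy) \<Rightarrow>
    (nat \<Rightarrow> 's state \<Rightarrow> real) \<Rightarrow> ('s state \<Rightarrow> real) \<Rightarrow> real" where
  "dual_regret M K s1 \<pi>s lams lam_c =
     (\<Sum>k=1..K. lagrangian M (s1 k) (\<pi>s k) (lams k) - lagrangian M (s1 k) (\<pi>s k) lam_c)"

definition dual_optimal :: "('s, 'a) mdp \<Rightarrow> ('s state \<Rightarrow> real) \<Rightarrow> bool" where
  "dual_optimal M lam \<longleftrightarrow> (\<forall>s\<in>feasible M.
     is_arg_min
       (\<lambda>y. maximum_over (policies M) (\<lambda>\<pi>. V M \<pi> (reward M) 1 s - y * V M \<pi> (cost M) 1 s))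
       (\<lambda>y. 0 \<le> y) (lam s))"

definition shared_saddle_point ::
  "('s, 'a) mdp \<Rightarrow> ('s, 'a) policy \<Rightarrow> ('s state \<Rightarrow> real) \<Rightarrow> bool" where
  "shared_saddle_point M \<pi>' lam' \<longleftrightarrow> \<pi>' \<in> policies M \<and>
     (\<forall>\<pi>\<in>policies M. \<forall>lam :: 's state \<Rightarrow> real. \<forall>s\<in>feasible M.
        lagrangian M s \<pi>' lam \<ge> lagrangian M s \<pi>' lam' \<and>
        lagrangian M s \<pi>' lam' \<ge> lagrangian M s \<pi> lam')"

end

theory Submission
  imports Defs
begin

text \<open>
  Since the saddle-point inequality holds for all real multipliers, positive and negative, the
  saddle policy has cost zero at every feasible state, so it is an avoiding policy on which the
  multipliers have no effect.  Hence the primal and the dual regret telescope, and what remains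
  is the optimality of the saddle policy in the Lagrangian game at the multiplier \<open>lam_hat\<close>.
  The additional unit in \<open>lam_star\<close> yields the number of resets.
\<close>

text \<open>Since \<open>maximum_over\<close> is unspecified when no maximum is attained, a bound on
  all values does not suffice: a maximiser has to be exhibited.\<close>

lemma maximum_over_eqI:
  assumes "x \<in> X" and "\<And>y. y \<in> X \<Longrightarrow> f y \<le> f x"
  shows "maximum_over X f = f x"
  unfolding maximum_over_def using assms by (intro Greatest_equality) auto

lemma lagrangian_cost_zero:
  assumes "V M \<pi> (cost M) 1 s = 0"
  shows "lagrangian M s \<pi> lam = V M \<pi> (reward M) 1 s"
  using assms by (simp add: lagrangian_def)

lemma saddle_cost_zero:
  assumes "shared_saddle_point M \<pi>' lam'" and "s \<in> feasible M"
  shows "V M \<pi>' (cost M) 1 s = 0"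
proof -
  let ?c = "V M \<pi>' (cost M) 1 s"
  \<comment> \<open>Raising the multiplier at \<open>s\<close> by \<open>?c\<close> lowers the
    Lagrangian by \<open>?c * ?c\<close>, whatever the sign of \<open>?c\<close>, while the saddle
    point allows no decrease.\<close>
  have "lagrangian M s \<pi>' lam' \<le> lagrangian M s \<pi>' (\<lambda>_. lam' s + ?c)"
    using assms by (auto simp: shared_saddle_point_def)
  then have "?c * ?c \<le> 0"
    by (simp add: lagrangian_def algebra_simps)
  then show ?thesis
    by (metis mult_eq_0_iff order_antisym zero_le_square)
qed

text \<open>The cost of \<open>\<pi>'\<close> vanishes, so the saddle value is its plain reward. As
  \<open>\<pi>\<close> may incur cost, this serves the played policies as well as the avoiding
  ones.\<close>

lemma saddle_reward_ge:
  assumes "shared_saddle_point M \<pi>' lam'" and "s \<in> feasible M" and "\<pi> \<in> policies M"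
  shows "lagrangian M s \<pi> lam' \<le> V M \<pi>' (reward M) 1 s"
proof -
  have "lagrangian M s \<pi> lam' \<le> lagrangian M s \<pi>' lam'"
    using assms by (auto simp: shared_saddle_point_def)
  then show ?thesis
    by (simp only: lagrangian_cost_zero[OF saddle_cost_zero[OF assms(1,2)]])
qed

text \<open>One avoiding policy witnesses feasibility of all initial states at once, which makes the
  saddle inequalities available in every episode.\<close>

lemma initial_states_feasible:
  assumes "\<forall>k\<in>{1..K}. s1 k \<in> space (layer M 1)" and "avoiding_policies M K s1 \<noteq> {}"
    and "k \<in> {1..K}"
  shows "s1 k \<in> feasible M"
proof -
  obtain \<pi> where "\<pi> \<in> avoiding_policies M K s1"
    using assms(2) by blast
  then have "\<pi> \<in> policies M" "V M \<pi> (cost M) 1 (s1 k) \<le> 0"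
    using assms(3) by (auto simp: avoiding_policies_def)
  then show ?thesis
    using assms(1,3) by (auto simp: feasible_def)
qed

text \<open>The saddle policy is itself avoiding and beats every avoiding policy in each episode
  separately, so it attains the maximum of the sums.\<close>

lemma regret_eq_saddle:
  assumes saddle: "shared_saddle_point M \<pi>' lam'"
    and feas: "\<And>k. k \<in> {1..K} \<Longrightarrow> s1 k \<in> feasible M"
  shows "regret M K s1 \<pi>s
    = (\<Sum>k=1..K. V M \<pi>' (reward M) 1 (s1 k) - V M (\<pi>s k) (reward M) 1 (s1 k))"
  unfolding regret_def
proof (rule maximum_over_eqI)
  show "\<pi>' \<in> avoiding_policies M K s1"
    using saddle saddle_cost_zero[OF saddle feas]
    by (simp add: avoiding_policies_def shared_saddle_point_def)
next
  fix \<pi> assume \<pi>: "\<pi> \<in> avoiding_policies M K s1"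
  show "(\<Sum>k=1..K. V M \<pi> (reward M) 1 (s1 k) - V M (\<pi>s k) (reward M) 1 (s1 k))
      \<le> (\<Sum>k=1..K. V M \<pi>' (reward M) 1 (s1 k) - V M (\<pi>s k) (reward M) 1 (s1 k))"
  proof (rule sum_mono)
    fix k assume k: "k \<in> {1..K}"
    have "\<pi> \<in> policies M" and "V M \<pi> (cost M) 1 (s1 k) = 0"
      using \<pi> k by (simp_all add: avoiding_policies_def)
    then have "V M \<pi> (reward M) 1 (s1 k) \<le> V M \<pi>' (reward M) 1 (s1 k)"
      using saddle_reward_ge[OF saddle feas[OF k]] by (metis lagrangian_cost_zero)
    then show "V M \<pi> (reward M) 1 (s1 k) - V M (\<pi>s k) (reward M) 1 (s1 k)
        \<le> V M \<pi>' (reward M) 1 (s1 k) - V M (\<pi>s k) (reward M) 1 (s1 k)"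
      by simp
  qed
qed

text \<open>The payoffs of \<open>\<pi>s k\<close> against \<open>lams k\<close> cancel, and the
  payoff of \<open>\<pi>'\<close> does not depend on \<open>lams k\<close> because its cost is
  zero.\<close>

lemma primal_plus_dual_regret:
  assumes "shared_saddle_point M \<pi>' lam'"
    and "\<And>k. k \<in> {1..K} \<Longrightarrow> s1 k \<in> feasible M"
  shows "primal_regret M K s1 \<pi>s lams \<pi>' + dual_regret M K s1 \<pi>s lams lam_c
    = (\<Sum>k=1..K. V M \<pi>' (reward M) 1 (s1 k) - lagrangian M (s1 k) (\<pi>s k) lam_c)"
  unfolding primal_regret_def dual_regret_def sum.distrib[symmetric]
  by (intro sum.cong refl)
    (simp add: lagrangian_cost_zero[OF saddle_cost_zero[OF assms(1) assms(2)]])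

theorem theorem4p5:
  fixes M :: "('s, 'a) mdp"
    and K :: nat
    and s1 :: "nat \<Rightarrow> 's state"
    and \<pi>s :: "nat \<Rightarrow> ('s, 'a) policy"
    and lams :: "nat \<Rightarrow> 's state \<Rightarrow> real"
    and \<pi>_star :: "('s, 'a) policy"
    and lam_hat lam_star :: "'s state \<Rightarrow> real"
  assumes "reset_mdp M"
    and "\<forall>k\<in>{1..K}. s1 k \<in> space (layer M 1)"
    and "avoiding_policies M K s1 \<noteq> {}"
    and "dual_optimal M lam_hat"
    and "shared_saddle_point M \<pi>_star lam_hat"
    and "lam_star = (\<lambda>s. lam_hat s + 1)"
    and "\<forall>k\<in>{1..K}. \<pi>s k \<in> policies M"
  shows "regret M K s1 \<pi>s
           \<le> primal_regret M K s1 \<pi>s lams \<pi>_star + dual_regret M K s1 \<pi>s lams (\<lambda>_. 0)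
       \<and> resets M K s1 \<pi>s
           \<le> primal_regret M K s1 \<pi>s lams \<pi>_star + dual_regret M K s1 \<pi>s lams lam_star"
proof -
  note saddle = assms(5)
  have feas: "s1 k \<in> feasible M" if "k \<in> {1..K}" for k
    using initial_states_feasible[OF assms(2,3) that] .
  have total: "primal_regret M K s1 \<pi>s lams \<pi>_star + dual_regret M K s1 \<pi>s lams lam_c
      = (\<Sum>k=1..K. V M \<pi>_star (reward M) 1 (s1 k) - lagrangian M (s1 k) (\<pi>s k) lam_c)" for lam_c
    using saddle feas by (rule primal_plus_dual_regret)
  have "regret M K s1 \<pi>s
      = (\<Sum>k=1..K. V M \<pi>_star (reward M) 1 (s1 k) - V M (\<pi>s k) (reward M) 1 (s1 k))"
    using saddle feas by (rule regret_eq_saddle)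
  then have "regret M K s1 \<pi>s
      = primal_regret M K s1 \<pi>s lams \<pi>_star + dual_regret M K s1 \<pi>s lams (\<lambda>_. 0)"
    unfolding total by (simp add: lagrangian_def)
  moreover have "resets M K s1 \<pi>s
      \<le> primal_regret M K s1 \<pi>s lams \<pi>_star + dual_regret M K s1 \<pi>s lams lam_star"
    unfolding total resets_def
  proof (rule sum_mono)
    fix k assume k: "k \<in> {1..K}"
    have "lagrangian M (s1 k) (\<pi>s k) lam_hat \<le> V M \<pi>_star (reward M) 1 (s1 k)"
      using saddle_reward_ge[OF saddle feas[OF k]] assms(7) k by blast
    \<comment> \<open>Passing from \<open>lam_hat\<close> to \<open>lam_star\<close> subtracts
      exactly one copy of the cost of \<open>\<pi>s k\<close> from the Lagrangian.\<close>
    then show "V M (\<pi>s k) (cost M) 1 (s1 k)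
        \<le> V M \<pi>_star (reward M) 1 (s1 k) - lagrangian M (s1 k) (\<pi>s k) lam_star"
      by (simp add: assms(6) lagrangian_def algebra_simps)
  qed
  ultimately show ?thesis
    by simp
qed

end
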